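(* For every vector of power injections $s=(s_j, j\in N^+)\in\mathbb C^{n+1}$, the solution sets of the bus injection model and of the branch flow model are equivalent, i.e. there is a bijection between $\mathbb V(s)$ and $\tilde{\mathbb X}(s)$.
   Context: Let $N^+=\{0,1,\dots,n\}$ and let $\tilde G=(N^+,\tilde E)$ be a connected directed graph obtained by arbitrarily orienting the edges of a connected undirected simple graph $G=(N^+,E)$; so for each undirected edge exactly one of $j\to k$, $k\to j$ is in $\tilde E$. Let $m=|\tilde E|$. Write $j\sim k$ if $j$ and $k$ are joined by an edge. Each line has a nonzero complex admittance $y_{jk}=y_{kj}$ and impedance $z_{jk}=1/y_{jk}$. $a^H$ denotes complex conjugate. In both models $V_0=1$ is fixed (slack bus), although $V_0$ is included in the vector $V=(V_j,j\in N^+)$. Bus injection model: $\mathbb V(s)$ is the set of $V\in\mathbb C^{n+1}$ (with $V_0=1$) such that $s_j=\sum_{k:j\sim k} y_{jk}^H V_j(V_j^H-V_k^H)$ for all $j\in N^+$. Branch flow model: $\tilde{\mathbb X}(s)$ is the set of $\tilde x=(S,I,V)\in\mathbb C^{2m+n+1}$, with $S=(S_{jk})_{j\to k\in\tilde E}$, $I=(I_{jk})_{j\to k\in\tilde E}$, $V=(V_j)_{j\in N^+}$, $V_0=1$, such that - $\sum_{k:j\to k}S_{jk}=\sum_{i:i\to j}(S_{ij}-z_{ij}|I_{ij}|^2)+s_j$ for all $j\in N^+$; - $I_{jk}=y_{jk}(V_j-V_k)$ for all $j\to k\in\tilde E$; - $S_{jk}=V_jI_{jk}^H$ for all $j\to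 k\in\tilde E$. *)

theory Defs
  imports
    Complex_Main
    "HOL-Library.FuncSet"
    "Graph_Theory.Digraph_Component"
    "Graph_Theory.Pair_Digraph"
begin

text \<open>
  An undirected simple graph is a \<^locale>\<open>pair_graph\<close>: finite, loop-free, with a symmetric arc
  relation, so that j and k are adjacent iff \<^prop>\<open>(j, k) \<in> parcs G\<close>.
\<close>

definition orientation_of :: "'a pair_pre_digraph \<Rightarrow> 'a pair_pre_digraph \<Rightarrow> bool" where
  "orientation_of D G \<longleftrightarrow>
     pverts D = pverts G \<and> parcs D \<subseteq> parcs G \<and>
     (\<forall>j k. (j, k) \<in> parcs G \<longrightarrow> ((j, k) \<in> parcs D) \<noteq> ((k, j) \<in> parcs D))"

definition impedance :: "('a \<Rightarrow> 'a \<Rightarrow> complex) \<Rightarrow> 'a \<Rightarrow> 'a \<Rightarrow> complex" where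
  "impedance y j k = 1 / y j k"

text \<open>
  Complex vectors indexed by a finite set A are extensional functions
  \<open>A \<rightarrow>\<^sub>E UNIV\<close>, so that equality of vectors is equality of their components.
  The slack bus is node 0.
\<close>

definition bus_injection_solutions ::
    "nat pair_pre_digraph \<Rightarrow> (nat \<Rightarrow> nat \<Rightarrow> complex) \<Rightarrow> (nat \<Rightarrow> complex) \<Rightarrow> (nat \<Rightarrow> complex) set" where
  "bus_injection_solutions G y s =
     {V \<in> pverts G \<rightarrow>\<^sub>E UNIV.
        V 0 = 1 \<and>
        (\<forall>j \<in> pverts G.
           s j = (\<Sum>k | (j, k) \<in> parcs G. cnj (y j k) * V j * (cnj (V j) - cnj (V k))))}"

definition branch_flow_solutions ::
    "nat pair_pre_digraph \<Rightarrow> (nat \<Rightarrow> nat \<Rightarrow> complex) \<Rightarrow> (nat \<Rightarrow> complex) \<Rightarrow>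
     ((nat \<times> nat \<Rightarrow> complex) \<times> (nat \<times> nat \<Rightarrow> complex) \<times> (nat \<Rightarrow> complex)) set" where
  "branch_flow_solutions D y s =
     {(S, I, V).
        S \<in> parcs D \<rightarrow>\<^sub>E UNIV \<and> I \<in> parcs D \<rightarrow>\<^sub>E UNIV \<and> V \<in> pverts D \<rightarrow>\<^sub>E UNIV \<and>
        V 0 = 1 \<and>
        (\<forall>j \<in> pverts D.
           (\<Sum>k | (j, k) \<in> parcs D. S (j, k)) =
           (\<Sum>i | (i, j) \<in> parcs D.
              S (i, j) - impedance y i j * complex_of_real ((cmod (I (i, j)))\<^sup>2)) + s j) \<and>
        (\<forall>j k. (j, k) \<in> parcs D \<longrightarrow> I (j, k) = y j k * (V j - V k)) \<and>
        (\<forall>j k. (j, k) \<in> parcs D \<longrightarrow> S (j, k) = V j * cnj (I (j, k)))}"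

end

theory Submission
  imports Defs
begin

text \<open>
  Ohm's law and \<open>S\<^sub>j\<^sub>k = V\<^sub>j I\<^sub>j\<^sub>k\<^sup>H\<close> determine the flows from the voltages, so projecting onto \<open>V\<close>
  inverts the map that adjoins them. On a line \<open>i \<rightarrow> j\<close>, the power \<open>S\<^sub>i\<^sub>j - z\<^sub>i\<^sub>j |I\<^sub>i\<^sub>j|\<^sup>2\<close> received
  at \<open>j\<close> is the negative of the power injected into the line at \<open>j\<close>; hence power balance
  at \<open>j\<close> in the branch flow model is the injection equation, with the sum over the neighbours of
  \<open>j\<close> split by orientation.
\<close>

definition line_current :: "('a \<Rightarrow> 'a \<Rightarrow> complex) \<Rightarrow> ('a \<Rightarrow> complex) \<Rightarrow> 'a \<times> 'a \<Rightarrow> complex" where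
  "line_current y V = (\<lambda>(j, k). y j k * (V j - V k))"

text \<open>Total on ordered pairs, so that it gives the power entering a line at either end,
  whichever way the line is oriented. In particular, it is the summand of the injection
  equation.\<close>

definition line_power :: "('a \<Rightarrow> 'a \<Rightarrow> complex) \<Rightarrow> ('a \<Rightarrow> complex) \<Rightarrow> 'a \<times> 'a \<Rightarrow> complex" where
  "line_power y V = (\<lambda>(j, k). cnj (y j k) * V j * (cnj (V j) - cnj (V k)))"

lemma line_power_eq: "line_power y V (j, k) = V j * cnj (line_current y V (j, k))"
  by (simp add: line_power_def line_current_def)

text \<open>Since \<open>z * y = 1\<close>, the loss is \<open>(V i - V j)\<close> times the
  conjugate current. Subtracting it leaves \<open>V j\<close> times that conjugate, and symmetry of
  \<open>y\<close> makes the current from \<open>i\<close> to \<open>j\<close> the negative of the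
  one from \<open>j\<close> to \<open>i\<close>.\<close>

lemma line_power_received:
  assumes "y i j = y j i" "y i j \<noteq> 0"
  shows "line_power y V (i, j)
           - impedance y i j * complex_of_real ((cmod (line_current y V (i, j)))\<^sup>2)
         = - line_power y V (j, i)"
  using assms
  by (simp add: complex_norm_square line_power_def line_current_def impedance_def field_simps
           del: of_real_power)

lemma orientation_sum_split:
  fixes g :: "'a \<Rightarrow> 'b::comm_monoid_add"
  assumes "pair_graph G" "orientation_of D G"
  shows "(\<Sum>k | (j, k) \<in> parcs G. g k) = (\<Sum>k | (j, k) \<in> parcs D. g k) + (\<Sum>i | (i, j) \<in> parcs D. g i)"
proof -
  interpret pair_graph G by fact
  have sym: "(k, j) \<in> parcs G" if "(j, k) \<in> parcs G" for j k
    using that arcs_symmetric by blast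
  have split: "{k. (j, k) \<in> parcs G} = {k. (j, k) \<in> parcs D} \<union> {i. (i, j) \<in> parcs D}"
    and disj: "{k. (j, k) \<in> parcs D} \<inter> {i. (i, j) \<in> parcs D} = {}"
    using assms(2) sym unfolding orientation_of_def by blast+
  \<comment> \<open>Neighbours of \<open>j\<close> are second components of the finitely many
    arcs.\<close>
  have "finite {k. (j, k) \<in> parcs G}"
    by (rule finite_subset[OF _ finite_imageI[OF pair_finite_arcs, of snd]]) force
  then show ?thesis
    using split disj by (simp add: sum.union_disjoint)
qed

lemma power_balance_iff_injection:
  assumes "pair_graph G" "orientation_of D G"
    and "\<forall>j k. (j, k) \<in> parcs G \<longrightarrow> y j k = y k j"
    and "\<forall>j k. (j, k) \<in> parcs G \<longrightarrow> y j k \<noteq> 0"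
  shows "(\<Sum>k | (j, k) \<in> parcs D. line_power y V (j, k)) =
         (\<Sum>i | (i, j) \<in> parcs D. line_power y V (i, j)
            - impedance y i j * complex_of_real ((cmod (line_current y V (i, j)))\<^sup>2)) + c
     \<longleftrightarrow> c = (\<Sum>k | (j, k) \<in> parcs G. line_power y V (j, k))"
proof -
  have "(\<Sum>i | (i, j) \<in> parcs D. line_power y V (i, j)
            - impedance y i j * complex_of_real ((cmod (line_current y V (i, j)))\<^sup>2))
      = (\<Sum>i | (i, j) \<in> parcs D. - line_power y V (j, i))"
    using assms(2-4) unfolding orientation_of_def
    by (intro sum.cong refl line_power_received) blast+
  \<comment> \<open>Moved to the left, the incoming terms supply the neighbours of \<open>j\<close>
    that the outgoing sum misses.\<close>
  then show ?thesis
    by (auto simp: orientation_sum_split[OF assms(1,2)] sum_negf algebra_simps)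
qed

lemma branch_flow_solutions_eq:
  assumes "pair_graph G" "orientation_of D G"
    and "\<forall>j k. (j, k) \<in> parcs G \<longrightarrow> y j k = y k j"
    and "\<forall>j k. (j, k) \<in> parcs G \<longrightarrow> y j k \<noteq> 0"
  shows "branch_flow_solutions D y s =
         (\<lambda>V. (restrict (line_power y V) (parcs D), restrict (line_current y V) (parcs D), V))
           ` bus_injection_solutions G y s"
proof -
  \<comment> \<open>Extensionality fixes \<open>S\<close> and \<open>I\<close> to be
    \<open>undefined\<close> off \<open>parcs D\<close>, so the equations on arcs determine them as
    functions.\<close>
  have flows: "S \<in> parcs D \<rightarrow>\<^sub>E UNIV \<and> I \<in> parcs D \<rightarrow>\<^sub>E UNIV \<and>
      (\<forall>j k. (j, k) \<in> parcs D \<longrightarrow> I (j, k) = y j k * (V j - V k)) \<and>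
      (\<forall>j k. (j, k) \<in> parcs D \<longrightarrow> S (j, k) = V j * cnj (I (j, k)))
    \<longleftrightarrow> S = restrict (line_power y V) (parcs D) \<and> I = restrict (line_current y V) (parcs D)"
    for S I V
    by (auto simp: fun_eq_iff line_power_eq line_current_def PiE_def extensional_def)
  have injection: "V \<in> bus_injection_solutions G y s \<longleftrightarrow>
      V \<in> pverts D \<rightarrow>\<^sub>E UNIV \<and> V 0 = 1 \<and>
      (\<forall>j \<in> pverts D. s j = (\<Sum>k | (j, k) \<in> parcs G. line_power y V (j, k)))" for V
    using assms(2) by (simp add: bus_injection_solutions_def line_power_def orientation_of_def)
  have "(S, I, V) \<in> branch_flow_solutions D y s \<longleftrightarrow>
      S = restrict (line_power y V) (parcs D) \<and> I = restrict (line_current y V) (parcs D) \<and>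
      V \<in> bus_injection_solutions G y s" for S I V
  proof -
    have "(S, I, V) \<in> branch_flow_solutions D y s \<longleftrightarrow>
        (S = restrict (line_power y V) (parcs D) \<and> I = restrict (line_current y V) (parcs D)) \<and>
        V \<in> pverts D \<rightarrow>\<^sub>E UNIV \<and> V 0 = 1 \<and>
        (\<forall>j \<in> pverts D. (\<Sum>k | (j, k) \<in> parcs D. S (j, k)) =
           (\<Sum>i | (i, j) \<in> parcs D.
              S (i, j) - impedance y i j * complex_of_real ((cmod (I (i, j)))\<^sup>2)) + s j)"
      unfolding flows[symmetric] branch_flow_solutions_def by blast
    also have "\<dots> \<longleftrightarrow>
        (S = restrict (line_power y V) (parcs D) \<and> I = restrict (line_current y V) (parcs D)) \<and>
        V \<in> bus_injection_solutions G y s"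
      \<comment> \<open>The balance equations are compared with \<open>S\<close> and
        \<open>I\<close> already known; the sums run over arcs of \<open>D\<close> only, where the
        restrictions have no effect.\<close>
      unfolding injection by (intro conj_cong refl ball_cong)
        (simp add: power_balance_iff_injection[OF assms] del: of_real_power)
    finally show ?thesis by simp
  qed
  then show ?thesis by auto
qed

theorem theorem1:
  fixes n :: nat
    and G D :: "nat pair_pre_digraph"
    and y :: "nat \<Rightarrow> nat \<Rightarrow> complex"
    and s :: "nat \<Rightarrow> complex"
  assumes "pair_graph G"
    and "pverts G = {0..n}"
    and "Digraph_Component.connected (with_proj G)"
    and "orientation_of D G"
    and "\<And>j k. (j, k) \<in> parcs G \<Longrightarrow> y j k = y k j"
    and "\<And>j k. (j, k) \<in> parcs G \<Longrightarrow> y j k \<noteq> 0"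
  shows "\<exists>f. bij_betw f (bus_injection_solutions G y s) (branch_flow_solutions D y s)"
proof -
  let ?f = "\<lambda>V. (restrict (line_power y V) (parcs D), restrict (line_current y V) (parcs D), V)"
  have "branch_flow_solutions D y s = ?f ` bus_injection_solutions G y s"
    using assms by (intro branch_flow_solutions_eq) blast+
  \<comment> \<open>Injectivity is immediate, as \<open>V\<close> is itself a component of its
    image.\<close>
  then have "bij_betw ?f (bus_injection_solutions G y s) (branch_flow_solutions D y s)"
    by (simp add: bij_betw_def inj_on_def)
  then show ?thesis
    by blast
qed

end
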